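(* Let $f(u,v,s)=\big(u,\ u^2f_{21}(u)+v^2+usf_{24}(u,s),\ u^2f_{31}(u)+v^2f_{32}(u,v,s)+usf_{34}(u,s)\big)$ with $f_{32}=c_0(u,s)+vc_1(u,s)+v^2c_2(u,v^2,s)+v^3c_3(u,v^2,s)$, $c_0(0,0)=0$, and $$c_1(u,s)=s+usd_1(s)+u^2d_2(s)+u^3d_3(s)+u^4d_4(u,s)$$ with smooth $d_1,d_2,d_3,d_4$ and $d_2(0)>0$; put $d_{20}=\sqrt{d_2(0)}>0$. For $s=-\tilde s^2$, the points of $S_2(f)$ (singular points of $f(\cdot,\cdot,s)$ that are not cuspidal edges, i.e. $\{v=0,\ c_1(u,s)=0\}$) satisfy $v=0$ and $u=u(\pm\tilde s)$, where $u(\tilde s)$ is a smooth function with expansion $$u(\tilde s)=\frac{1}{d_{20}}\tilde s+\frac{1}{2d_{20}^4}\big(d_1(0)d_{20}^2-d_3(0)\big)\tilde s^2+\frac{1}{8d_{20}^7}\Big(\big(d_1(0)^2+4d_2'(0)\big)d_{20}^4-2\big(3d_1(0)d_3(0)+2d_4(0,0)\big)d_{20}^2+5d_3(0)^2\Big)\tilde s^3+O(\tilde s^4).$$ Moreover, for $\tilde s\neq0$ small, the germs of $f(\cdot,\cdot,-\tilde s^2)$ at $(u(\tilde s),0)$ and at $(u(-\tilde s),0)$ are both cuspidal cross caps.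
   Context: Here $f_{21},f_{31}$ are smooth in $u$, $f_{24},f_{34},c_0,c_1$ smooth in $(u,s)$, $c_2,c_3$ smooth in $(u,w,s)$. A cuspidal cross cap is a map-germ $\mathcal{A}$-equivalent to $(u,v)\mapsto(u,v^2,v^3u)$ at the origin (equivalently $(u,v^2,v^3(u\pm v^2))$), where $\mathcal{A}$-equivalence means equality after composing with diffeomorphism-germs of source and target. For each fixed $s$, $f(\cdot,\cdot,s)$ is a frontal with singular set $\{v=0\}$. *)

theory Defs
  imports "HOL-Analysis.Analysis"
begin

text \<open>C-infinity smoothness on an open neighbourhood of a point: all iterated
Frechet derivatives exist. D vs x is the iterated derivative of f at x applied to the
directions in vs (D [] = f on U).\<close>
definition smooth_near :: "('a::real_normed_vector \<Rightarrow> 'b::real_normed_vector) \<Rightarrow> 'a \<Rightarrow> bool" where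
  "smooth_near f a \<longleftrightarrow> (\<exists>U D. open U \<and> a \<in> U \<and> (\<forall>x\<in>U. D [] x = f x) \<and>
      (\<forall>vs. \<forall>x\<in>U. (D vs has_derivative (\<lambda>v. D (v # vs) x)) (at x)))"

definition diffeo_germ :: "('a::real_normed_vector \<Rightarrow> 'a) \<Rightarrow> 'a \<Rightarrow> 'a \<Rightarrow> bool" where
  "diffeo_germ \<phi> p q \<longleftrightarrow> \<phi> p = q \<and> smooth_near \<phi> p \<and>
     (\<exists>\<psi>. \<psi> q = p \<and> smooth_near \<psi> q \<and>
        (\<forall>\<^sub>F x in nhds p. \<psi> (\<phi> x) = x) \<and> (\<forall>\<^sub>F y in nhds q. \<phi> (\<psi> y) = y))"

definition A_equiv :: "('a::real_normed_vector \<Rightarrow> 'b::real_normed_vector) \<Rightarrow> 'a \<Rightarrow> ('a \<Rightarrow> 'b) \<Rightarrow> 'a \<Rightarrow> bool" where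
  "A_equiv f p g q \<longleftrightarrow> (\<exists>\<sigma> \<tau>. diffeo_germ \<sigma> q p \<and> diffeo_germ \<tau> (f p) (g q) \<and>
      (\<forall>\<^sub>F x in nhds q. \<tau> (f (\<sigma> x)) = g x))"

definition ccr_std :: "real \<times> real \<Rightarrow> real \<times> real \<times> real" where
  "ccr_std = (\<lambda>(u, v). (u, v^2, v^3 * u))"

definition cuspidal_cross_cap_at :: "(real \<times> real \<Rightarrow> real \<times> real \<times> real) \<Rightarrow> real \<times> real \<Rightarrow> bool" where
  "cuspidal_cross_cap_at f p \<longleftrightarrow> A_equiv f p ccr_std (0, 0)"

end

theory Submission
  imports Defs "HOL-Library.Landau_Symbols"
begin

text \<open>
  Substituting \<^term>\<open>u = t * x\<close> and \<^term>\<open>s = - (t^2)\<close> gives \<open>c1 (t x, -t\<^sup>2) = t\<^sup>2 F (x, t)\<close> with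
  \<^term>\<open>F\<close> smooth, \<open>F (1/D, 0) = 0\<close> and \<open>F\<^sub>x (1/D, 0) = 2D\<close>. The implicit function theorem
  yields a smooth root \<open>w\<close> of \<open>F (w t, t) = 0\<close>, and \<open>u(t) = t w(t)\<close>; the roots of \<^term>\<open>c1\<close> near
  the origin have \<open>\<bar>u / t\<bar>\<close> close to \<open>1/D\<close>, so they are \<open>u(t)\<close> and \<open>u(-t)\<close>. The quadratic
  polynomial \<open>P\<close> with the claimed coefficients satisfies \<open>F (P t, t) = O(t\<^sup>3)\<close>, which forces
  \<open>w - P = O(t\<^sup>3)\<close>. Finally \<open>\<partial>c1/\<partial>u = t F\<^sub>x \<noteq> 0\<close> at these roots, and a transversal zero of \<^term>\<open>c1\<close>
  gives a cuspidal cross cap through explicit coordinate changes.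
\<close>

section \<open>Calculus of smooth germs\<close>

text \<open>Smoothness counted derivative by derivative, so that the chain rule and the implicit function
  theorem can be proved by induction on the order.\<close>

primrec times_differentiable_on ::
  "nat \<Rightarrow> 'a::real_normed_vector set \<Rightarrow> ('a \<Rightarrow> 'b::real_normed_vector) \<Rightarrow> bool" where
  "times_differentiable_on 0 U f \<longleftrightarrow> True"
| "times_differentiable_on (Suc k) U f \<longleftrightarrow>
     (\<exists>f'. (\<forall>x\<in>U. (f has_derivative f' x) (at x)) \<and>
        (\<forall>v. times_differentiable_on k U (\<lambda>x. f' x v)))"

lemma times_differentiable_on_SucI:
  assumes "\<And>x. x \<in> U \<Longrightarrow> (f has_derivative f' x) (at x)"
    and "\<And>v. times_differentiable_on k U (\<lambda>x. f' x v)"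
  shows "times_differentiable_on (Suc k) U f"
  using assms by auto

lemma times_differentiable_on_isCont:
  assumes "times_differentiable_on (Suc k) U f" "x \<in> U"
  shows "isCont f x"
  using assms has_derivative_continuous unfolding times_differentiable_on.simps by blast

lemma times_differentiable_on_cong:
  assumes "open U" "\<And>x. x \<in> U \<Longrightarrow> f x = g x" "times_differentiable_on k U f"
  shows "times_differentiable_on k U g"
proof (cases k)
  case (Suc j)
  with assms(3) obtain f' where "\<forall>x\<in>U. (f has_derivative f' x) (at x)"
    "\<forall>v. times_differentiable_on j U (\<lambda>x. f' x v)"
    by auto
  moreover have "\<forall>x\<in>U. (g has_derivative f' x) (at x)"
    using calculation(1) assms(1,2) by (meson has_derivative_transform_within_open)
  ultimately show ?thesis
    using Suc by auto
qed simp

lemma times_differentiable_on_subset: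
  "times_differentiable_on k U f \<Longrightarrow> V \<subseteq> U \<Longrightarrow> times_differentiable_on k V f"
  by (induction k arbitrary: f) (auto, metis in_mono)

lemma times_differentiable_on_SucD:
  "times_differentiable_on (Suc k) U f \<Longrightarrow> times_differentiable_on k U f"
proof (induction k arbitrary: f)
  case (Suc k)
  then obtain f' where "\<forall>x\<in>U. (f has_derivative f' x) (at x)"
    "\<forall>v. times_differentiable_on (Suc k) U (\<lambda>x. f' x v)"
    by (metis times_differentiable_on.simps(2))
  with Suc.IH show ?case
    by auto
qed simp

text \<open>Each order supplies its own witness derivative, but on an open set derivatives are
  unique, so all witnesses agree with \<open>frechet_derivative\<close>. One canonical derivative
  then serves every order at once.\<close>

lemma times_differentiable_on_frechet_derivative:
  assumes "open U" "\<And>k. times_differentiable_on k U f"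
  shows "x \<in> U \<Longrightarrow> (f has_derivative frechet_derivative f (at x)) (at x)"
    and "times_differentiable_on k U (\<lambda>x. frechet_derivative f (at x) v)"
proof -
  obtain f' where f': "\<forall>x\<in>U. (f has_derivative f' x) (at x)"
    "\<forall>v. times_differentiable_on k U (\<lambda>x. f' x v)"
    using assms(2)[of "Suc k"] by auto
  then have eq: "frechet_derivative f (at x) = f' x" if "x \<in> U" for x
    using that frechet_derivative_at by metis
  show "x \<in> U \<Longrightarrow> (f has_derivative frechet_derivative f (at x)) (at x)"
    using f'(1) eq by simp
  show "times_differentiable_on k U (\<lambda>x. frechet_derivative f (at x) v)"
    by (rule times_differentiable_on_cong[OF assms(1) _ f'(2)[rule_format, of v]]) (simp add: eq)
qed

text \<open>A family \<open>D\<close> makes each \<open>D vs\<close> differentiable to every order,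
  by induction on the order with \<open>vs\<close> arbitrary. Conversely, iterating
  \<open>frechet_derivative\<close> along the list of directions produces such a family.\<close>

lemma smooth_near_iff_times_differentiable:
  "smooth_near f a \<longleftrightarrow> (\<exists>U. open U \<and> a \<in> U \<and> (\<forall>k. times_differentiable_on k U f))"
proof
  assume "smooth_near f a"
  then obtain U D where U: "open U" "a \<in> U" and D0: "\<forall>x\<in>U. D [] x = f x"
    and D: "\<forall>vs. \<forall>x\<in>U. (D vs has_derivative (\<lambda>v. D (v # vs) x)) (at x)"
    unfolding smooth_near_def by blast
  have "times_differentiable_on k U (D vs)" for k vs
  proof (induction k arbitrary: vs)
    case (Suc k)
    then show ?case
      unfolding times_differentiable_on.simps
      by (intro exI[of _ "\<lambda>x v. D (v # vs) x"]) (use D in auto)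
  qed simp
  then have "times_differentiable_on k U f" for k
    using times_differentiable_on_cong[OF U(1)] D0 by metis
  with U show "\<exists>U. open U \<and> a \<in> U \<and> (\<forall>k. times_differentiable_on k U f)"
    by blast
next
  assume "\<exists>U. open U \<and> a \<in> U \<and> (\<forall>k. times_differentiable_on k U f)"
  then obtain U where U: "open U" "a \<in> U" and f: "\<And>k. times_differentiable_on k U f"
    by blast
  \<comment> \<open>The head of the list is the direction of the last differentiation.\<close>
  define D where "D = rec_list f (\<lambda>v vs g x. frechet_derivative g (at x) v)"
  have D_Nil: "D [] = f" and D_Cons: "D (v # vs) = (\<lambda>x. frechet_derivative (D vs) (at x) v)" for v vs
    by (auto simp: D_def)
  note step = times_differentiable_on_frechet_derivative[OF U(1)]
  have D: "times_differentiable_on k U (D vs)" for k vs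
  proof (induction vs arbitrary: k)
    case (Cons v vs)
    then show ?case
      unfolding D_Cons by (rule step(2))
  qed (simp add: D_Nil f)
  show "smooth_near f a"
    unfolding smooth_near_def
  proof (intro exI[of _ U] exI[of _ D] conjI allI ballI)
    fix vs x assume "x \<in> U"
    then show "(D vs has_derivative (\<lambda>v. D (v # vs) x)) (at x)"
      unfolding D_Cons using step(1)[OF D] by simp
  qed (simp_all add: U D_Nil)
qed

section \<open>Closure properties at a fixed order of differentiability\<close>

lemma times_differentiable_on_const: "times_differentiable_on k U (\<lambda>x. c)"
proof (induction k arbitrary: c)
  case (Suc k)
  show ?case
    by (intro times_differentiable_on_SucI[of _ _ "\<lambda>x v. 0"] Suc) auto
qed simp

lemma times_differentiable_on_bounded_linear:
  assumes "bounded_linear f"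
  shows "times_differentiable_on k U f"
proof (cases k)
  case (Suc j)
  then show ?thesis
    unfolding Suc
    by (intro times_differentiable_on_SucI[of _ _ "\<lambda>x. f"] bounded_linear_imp_has_derivative
        times_differentiable_on_const assms)
qed simp

lemma times_differentiable_on_bounded_linear_compose:
  assumes "bounded_linear h" "times_differentiable_on k U f"
  shows "times_differentiable_on k U (\<lambda>x. h (f x))"
  using assms(2)
proof (induction k arbitrary: f)
  case (Suc k)
  then obtain f' where f': "\<forall>x\<in>U. (f has_derivative f' x) (at x)"
    "\<forall>v. times_differentiable_on k U (\<lambda>x. f' x v)"
    by auto
  then show ?case
    by (intro times_differentiable_on_SucI[of _ _ "\<lambda>x v. h (f' x v)"] Suc.IH
        bounded_linear.has_derivative[OF assms(1)]) auto
qed simp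

lemma times_differentiable_on_add:
  assumes "times_differentiable_on k U f" "times_differentiable_on k U g"
  shows "times_differentiable_on k U (\<lambda>x. f x + g x)"
  using assms
proof (induction k arbitrary: f g)
  case (Suc k)
  then obtain f' g' where "\<forall>x\<in>U. (f has_derivative f' x) (at x)"
    "\<forall>v. times_differentiable_on k U (\<lambda>x. f' x v)" "\<forall>x\<in>U. (g has_derivative g' x) (at x)"
    "\<forall>v. times_differentiable_on k U (\<lambda>x. g' x v)"
    by auto
  then show ?case
    by (intro times_differentiable_on_SucI[of _ _ "\<lambda>x v. f' x v + g' x v"] Suc.IH
        has_derivative_add) auto
qed simp

lemma times_differentiable_on_sum:
  assumes "finite I" "\<And>i. i \<in> I \<Longrightarrow> times_differentiable_on k U (f i)"
  shows "times_differentiable_on k U (\<lambda>x. \<Sum>i\<in>I. f i x)"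
  using assms
  by (induction I rule: finite_induct)
    (auto intro: times_differentiable_on_const times_differentiable_on_add)

lemma times_differentiable_on_scaleR:
  assumes "times_differentiable_on k U f" "times_differentiable_on k U g"
  shows "times_differentiable_on k U (\<lambda>x. f x *\<^sub>R g x)"
  using assms
proof (induction k arbitrary: f g)
  case (Suc k)
  then obtain f' g' where *: "\<forall>x\<in>U. (f has_derivative f' x) (at x)"
    "\<forall>v. times_differentiable_on k U (\<lambda>x. f' x v)" "\<forall>x\<in>U. (g has_derivative g' x) (at x)"
    "\<forall>v. times_differentiable_on k U (\<lambda>x. g' x v)"
    by auto
  \<comment> \<open>The product rule contains \<open>f\<close> and \<open>g\<close>
    undifferentiated, so they are needed at the lower order as well.\<close>
  have "times_differentiable_on k U f" "times_differentiable_on k U g"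
    using Suc.prems times_differentiable_on_SucD by blast+
  with * show ?case
    by (intro times_differentiable_on_SucI[of _ _ "\<lambda>x v. f x *\<^sub>R g' x v + f' x v *\<^sub>R g x"]
        Suc.IH times_differentiable_on_add has_derivative_scaleR) auto
qed simp

lemma times_differentiable_on_Pair:
  assumes "times_differentiable_on k U f" "times_differentiable_on k U g"
  shows "times_differentiable_on k U (\<lambda>x. (f x, g x))"
  using assms
proof (induction k arbitrary: f g)
  case (Suc k)
  then obtain f' g' where "\<forall>x\<in>U. (f has_derivative f' x) (at x)"
    "\<forall>v. times_differentiable_on k U (\<lambda>x. f' x v)" "\<forall>x\<in>U. (g has_derivative g' x) (at x)"
    "\<forall>v. times_differentiable_on k U (\<lambda>x. g' x v)"
    by auto
  then show ?case
    by (intro times_differentiable_on_SucI[of _ _ "\<lambda>x v. (f' x v, g' x v)"] Suc.IH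
        has_derivative_Pair) auto
qed simp

lemma times_differentiable_on_inverse:
  fixes f :: "'a::real_normed_vector \<Rightarrow> real"
  assumes "times_differentiable_on k U f" "\<And>x. x \<in> U \<Longrightarrow> f x \<noteq> 0"
  shows "times_differentiable_on k U (\<lambda>x. inverse (f x))"
  using assms(1)
proof (induction k)
  case (Suc k)
  then obtain f' where *: "\<forall>x\<in>U. (f has_derivative f' x) (at x)"
    "\<forall>v. times_differentiable_on k U (\<lambda>x. f' x v)"
    by auto
  have inv: "times_differentiable_on k U (\<lambda>x. inverse (f x))"
    using Suc times_differentiable_on_SucD by blast
  \<comment> \<open>The derivative \<open>- f' / f^2\<close> is written with scalar products only,
    so that the product lemma and the induction hypothesis for \<open>inverse (f x)\<close> cover
    it.\<close>
  have "times_differentiable_on k U (\<lambda>x. (- 1) *\<^sub>R (inverse (f x) *\<^sub>R (f' x v *\<^sub>R inverse (f x))))" for v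
    using * inv
    by (intro times_differentiable_on_scaleR times_differentiable_on_const) auto
  moreover have "((\<lambda>x. inverse (f x)) has_derivative
      (\<lambda>v. (- 1) *\<^sub>R (inverse (f x) *\<^sub>R (f' x v *\<^sub>R inverse (f x))))) (at x)" if "x \<in> U" for x
    using *(1) assms(2) that
    by (auto intro!: derivative_eq_intros simp: fun_eq_iff power2_eq_square field_simps)
  ultimately show ?case
    by (rule times_differentiable_on_SucI[rotated])
qed simp

text \<open>The chain rule evaluates \<open>f' (g x)\<close> in the direction \<open>g' x v\<close>,
  which moves with \<open>x\<close>, whereas the hypothesis on \<open>f\<close> concerns fixed
  directions. Expanding that direction in the basis of the Euclidean space \<open>'b\<close> reduces
  to finitely many fixed ones with differentiable coefficients.\<close>

lemma times_differentiable_on_compose: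
  fixes g :: "'a::real_normed_vector \<Rightarrow> 'b::euclidean_space"
    and f :: "'b \<Rightarrow> 'c::real_normed_vector"
  assumes "times_differentiable_on k U g" "times_differentiable_on k V f" "g ` U \<subseteq> V"
  shows "times_differentiable_on k U (\<lambda>x. f (g x))"
  using assms(1,2)
proof (induction k arbitrary: f)
  case (Suc k)
  then obtain f' g' where f': "\<forall>y\<in>V. (f has_derivative f' y) (at y)"
    "\<forall>v. times_differentiable_on k V (\<lambda>y. f' y v)"
    and g': "\<forall>x\<in>U. (g has_derivative g' x) (at x)"
    "\<forall>v. times_differentiable_on k U (\<lambda>x. g' x v)"
    by auto
  have g: "times_differentiable_on k U g"
    using Suc.prems times_differentiable_on_SucD by blast
  define h where "h x v = (\<Sum>b\<in>Basis. (g' x v \<bullet> b) *\<^sub>R f' (g x) b)" for x v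
  have h: "f' (g x) (g' x v) = h x v" if "x \<in> U" for x v
  proof -
    have "linear (f' (g x))"
      using f'(1) assms(3) that by (meson has_derivative_linear image_subset_iff)
    then have "f' (g x) (\<Sum>b\<in>Basis. (g' x v \<bullet> b) *\<^sub>R b) = h x v"
      by (simp add: linear_sum linear_scale h_def)
    then show ?thesis
      by (simp add: euclidean_representation)
  qed
  have "((\<lambda>x. f (g x)) has_derivative h x) (at x)" if "x \<in> U" for x
    using has_derivative_compose[of g "g' x" x UNIV f "f' (g x)"] f'(1) g'(1) assms(3) that
    by (auto simp: h[OF that])
  moreover have "times_differentiable_on k U (\<lambda>x. h x v)" for v
    unfolding h_def using f'(2) g'(2) g Suc.IH
    by (intro times_differentiable_on_sum times_differentiable_on_scaleR
        times_differentiable_on_bounded_linear_compose[OF bounded_linear_inner_left]) auto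
  ultimately show ?case
    by auto
qed simp

section \<open>Transfer of the closure properties to germs\<close>

lemma smooth_near_eventually:
  assumes "smooth_near f a"
  shows "\<forall>\<^sub>F x in nhds a. smooth_near f x"
  using assms unfolding smooth_near_iff_times_differentiable eventually_nhds by blast

lemma smooth_near_tendsto:
  assumes "smooth_near f a"
  shows "(f \<longlongrightarrow> f a) (nhds a)"
proof -
  obtain U where "a \<in> U" "times_differentiable_on (Suc 0) U f"
    using assms unfolding smooth_near_iff_times_differentiable by blast
  then show ?thesis
    using times_differentiable_on_isCont isCont_def tendsto_at_iff_tendsto_nhds by blast
qed

lemma smooth_near_bounded_linear: "bounded_linear f \<Longrightarrow> smooth_near f a"
  unfolding smooth_near_iff_times_differentiable
  using times_differentiable_on_bounded_linear by blast

lemma smooth_near_const: "smooth_near (\<lambda>x. c) a"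
  unfolding smooth_near_iff_times_differentiable
  using times_differentiable_on_const by blast

lemma smooth_near_add:
  assumes "smooth_near f a" "smooth_near g a"
  shows "smooth_near (\<lambda>x. f x + g x) a"
proof -
  obtain U V where "open U" "a \<in> U" "open V" "a \<in> V"
    "\<forall>k. times_differentiable_on k U f" "\<forall>k. times_differentiable_on k V g"
    using assms unfolding smooth_near_iff_times_differentiable by blast
  then show ?thesis
    unfolding smooth_near_iff_times_differentiable
    by (intro exI[of _ "U \<inter> V"])
      (auto intro!: times_differentiable_on_add intro: times_differentiable_on_subset)
qed

lemma smooth_near_scaleR:
  assumes "smooth_near f a" "smooth_near g a"
  shows "smooth_near (\<lambda>x. f x *\<^sub>R g x) a"
proof -
  obtain U V where "open U" "a \<in> U" "open V" "a \<in> V"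
    "\<forall>k. times_differentiable_on k U f" "\<forall>k. times_differentiable_on k V g"
    using assms unfolding smooth_near_iff_times_differentiable by blast
  then show ?thesis
    unfolding smooth_near_iff_times_differentiable
    by (intro exI[of _ "U \<inter> V"])
      (auto intro!: times_differentiable_on_scaleR intro: times_differentiable_on_subset)
qed

lemma smooth_near_Pair:
  assumes "smooth_near f a" "smooth_near g a"
  shows "smooth_near (\<lambda>x. (f x, g x)) a"
proof -
  obtain U V where "open U" "a \<in> U" "open V" "a \<in> V"
    "\<forall>k. times_differentiable_on k U f" "\<forall>k. times_differentiable_on k V g"
    using assms unfolding smooth_near_iff_times_differentiable by blast
  then show ?thesis
    unfolding smooth_near_iff_times_differentiable
    by (intro exI[of _ "U \<inter> V"])
      (auto intro!: times_differentiable_on_Pair intro: times_differentiable_on_subset)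
qed

lemma smooth_near_compose:
  fixes g :: "'a::real_normed_vector \<Rightarrow> 'b::euclidean_space"
    and f :: "'b \<Rightarrow> 'c::real_normed_vector"
  assumes "smooth_near f b" "smooth_near g a" "g a = b"
  shows "smooth_near (\<lambda>x. f (g x)) a"
proof -
  obtain U V where U: "open U" "a \<in> U" and V: "open V" "g a \<in> V"
    and fg: "\<forall>k. times_differentiable_on k U g" "\<forall>k. times_differentiable_on k V f"
    using assms(1,2) unfolding assms(3)[symmetric] smooth_near_iff_times_differentiable by blast
  have "times_differentiable_on (Suc 0) U g"
    using fg by blast
  then have "continuous_on U g"
    using times_differentiable_on_isCont U(1) by (metis continuous_on_eq_continuous_at)
  then have "open (U \<inter> g -` V)"
    using U(1) V(1) by (metis Int_commute continuous_on_open_vimage)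
  moreover have "times_differentiable_on k (U \<inter> g -` V) (\<lambda>x. f (g x))" for k
    by (rule times_differentiable_on_compose[of _ _ _ V])
      (use fg in \<open>auto intro: times_differentiable_on_subset\<close>)
  ultimately show ?thesis
    unfolding smooth_near_iff_times_differentiable
    using U V by (intro exI[of _ "U \<inter> g -` V"]) auto
qed

lemma smooth_near_mult:
  fixes f g :: "'a::real_normed_vector \<Rightarrow> real"
  assumes "smooth_near f a" "smooth_near g a"
  shows "smooth_near (\<lambda>x. f x * g x) a"
  using smooth_near_scaleR[OF assms] by simp

lemma smooth_near_minus: "smooth_near f a \<Longrightarrow> smooth_near (\<lambda>x. - f x) a"
  using smooth_near_scaleR[OF smooth_near_const[of "- 1"], of f a] by simp

lemma smooth_near_diff:
  assumes "smooth_near f a" "smooth_near g a"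
  shows "smooth_near (\<lambda>x. f x - g x) a"
  using smooth_near_add[OF assms(1) smooth_near_minus[OF assms(2)]] by simp

lemma smooth_near_power:
  fixes f :: "'a::real_normed_vector \<Rightarrow> real"
  assumes "smooth_near f a"
  shows "smooth_near (\<lambda>x. f x ^ n) a"
  by (induction n) (auto intro: smooth_near_const smooth_near_mult assms)

lemma smooth_near_ident: "smooth_near (\<lambda>x. x) a"
  by (rule smooth_near_bounded_linear[OF bounded_linear_ident])

lemma smooth_near_fst:
  fixes f :: "'a::real_normed_vector \<Rightarrow> 'b::euclidean_space \<times> 'c::euclidean_space"
  shows "smooth_near f a \<Longrightarrow> smooth_near (\<lambda>x. fst (f x)) a"
  by (auto intro: smooth_near_compose[OF smooth_near_bounded_linear[OF bounded_linear_fst]])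

lemma smooth_near_snd:
  fixes f :: "'a::real_normed_vector \<Rightarrow> 'b::euclidean_space \<times> 'c::euclidean_space"
  shows "smooth_near f a \<Longrightarrow> smooth_near (\<lambda>x. snd (f x)) a"
  by (auto intro: smooth_near_compose[OF smooth_near_bounded_linear[OF bounded_linear_snd]])

lemmas smooth_near_intros = smooth_near_const smooth_near_ident smooth_near_add smooth_near_diff
  smooth_near_minus smooth_near_mult smooth_near_power smooth_near_Pair smooth_near_fst
  smooth_near_snd

section \<open>The implicit function theorem\<close>

text \<open>The partial derivative is the Frechet derivative in the fixed direction
  \<open>(1, 0)\<close>, hence smooth in both variables jointly. Its continuity later gives a
  uniform lower bound near the base point.\<close>

lemma smooth_near_partial_derivative:
  fixes F :: "real \<times> 'a::euclidean_space \<Rightarrow> real"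
  assumes "smooth_near F p"
  obtains G where "smooth_near G p"
    "\<forall>\<^sub>F q in nhds p. ((\<lambda>x. F (x, snd q)) has_real_derivative G q) (at (fst q))"
proof -
  obtain U where U: "open U" "p \<in> U" and F: "\<And>k. times_differentiable_on k U F"
    using assms unfolding smooth_near_iff_times_differentiable by blast
  note F' = times_differentiable_on_frechet_derivative[OF U(1) F]
  define G where "G q = frechet_derivative F (at q) (1, 0)" for q
  have "((\<lambda>x. F (x, snd q)) has_real_derivative G q) (at (fst q))" if "q \<in> U" for q
  proof -
    have "((\<lambda>x. (x, snd q)) has_derivative (\<lambda>h. (h, 0))) (at (fst q))"
      by (auto intro!: derivative_eq_intros)
    from has_derivative_compose[OF this, of F] F'(1)[OF that]
    have "((\<lambda>x. F (x, snd q)) has_derivative (\<lambda>h. frechet_derivative F (at q) (h, 0))) (at (fst q))"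
      by simp
    moreover have "frechet_derivative F (at q) (h, 0) = G q * h" for h
      using linear_scale[OF has_derivative_linear[OF F'(1)[OF that]], of h "(1, 0)"]
      by (simp add: G_def mult.commute)
    ultimately show ?thesis
      by (simp add: has_field_derivative_def)
  qed
  moreover have "smooth_near G p"
    unfolding smooth_near_iff_times_differentiable G_def using U F'(2) by blast
  ultimately show ?thesis
    using that[of G] U unfolding eventually_nhds by blast
qed

text \<open>The inverse function theorem is applied to
  \<open>(x, y) \<mapsto> (F (x, y), y)\<close>, and \<open>k y\<close> is the first component of
  the inverse at \<open>(0, y)\<close>. Injectivity gives local uniqueness of the root. The inverse
  is known only to be differentiable once; higher orders follow by implicit differentiation.\<close>

lemma smooth_implicit_function:
  fixes F :: "real \<times> 'a::euclidean_space \<Rightarrow> real"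
  assumes "smooth_near F (x0, y0)" "F (x0, y0) = 0"
    and "((\<lambda>x. F (x, y0)) has_real_derivative d) (at x0)" "d \<noteq> 0"
  obtains k where "smooth_near k y0" "k y0 = x0" "\<forall>\<^sub>F y in nhds y0. F (k y, y) = 0"
    "\<forall>\<^sub>F p in nhds (x0, y0). F p = 0 \<longrightarrow> fst p = k (snd p)"
proof -
  obtain W where W: "open W" "(x0, y0) \<in> W" and F_W: "\<And>k. times_differentiable_on k W F"
    using assms(1) unfolding smooth_near_iff_times_differentiable by blast
  define F' where "F' p = frechet_derivative F (at p)" for p
  have F'_W: "p \<in> W \<Longrightarrow> (F has_derivative F' p) (at p)"
    "times_differentiable_on k W (\<lambda>p. F' p v)" for p k v
    unfolding F'_def using times_differentiable_on_frechet_derivative[OF W(1) F_W] by blast+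
  have cont_F': "continuous_on W (\<lambda>p. F' p v)" for v
    by (metis F'_W(2) W(1) continuous_on_eq_continuous_at times_differentiable_on_isCont)
  \<comment> \<open>On \<open>U\<close> the partial derivative in the first variable can be
    inverted, as the formula for \<open>k'\<close> requires.\<close>
  define U where "U = W \<inter> (\<lambda>p. F' p (1, 0)) -` (- {0})"
  have "open U"
    unfolding U_def by (metis Int_commute W(1) cont_F' continuous_on_open_vimage open_Compl closed_singleton)
  have split: "F' p v = F' p (1, 0) * fst v + F' p (0, snd v)" if "p \<in> W" for p v
  proof -
    have lin: "linear (F' p)"
      using F'_W(1) that has_derivative_linear by blast
    have "v = fst v *\<^sub>R (1, 0) + (0, snd v)"
      by (cases v) simp
    then have "F' p v = F' p (fst v *\<^sub>R (1, 0) + (0, snd v))"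
      by simp
    also have "\<dots> = F' p (1, 0) * fst v + F' p (0, snd v)"
      using lin by (simp add: linear_add linear_scale del: scaleR_Pair)
    finally show ?thesis .
  qed
  have "F' (x0, y0) (1, 0) = d"
  proof -
    have "((\<lambda>x. (x, y0)) has_derivative (\<lambda>h. (h, 0))) (at x0)"
      by (auto intro!: derivative_eq_intros)
    from has_derivative_compose[OF this, of F] F'_W(1)[OF W(2)]
    have "((\<lambda>x. F (x, y0)) has_derivative (\<lambda>h. F' (x0, y0) (h, 0))) (at x0)"
      by simp
    with assms(3) have "(*) d = (\<lambda>h. F' (x0, y0) (h, 0))"
      unfolding has_field_derivative_def using has_derivative_unique by blast
    from fun_cong[OF this, of 1] show ?thesis
      by simp
  qed
  with W(2) assms(4) have "(x0, y0) \<in> U"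
    by (simp add: U_def)
  define \<Phi> where "\<Phi> p = (F p, snd p)" for p
  define \<Phi>' where "\<Phi>' p = Blinfun (\<lambda>v. (F' p v, snd v))" for p
  have \<Phi>'_apply: "blinfun_apply (\<Phi>' p) = (\<lambda>v. (F' p v, snd v))" if "p \<in> U" for p
  proof -
    have "bounded_linear (F' p)"
      using F'_W(1) that has_derivative_bounded_linear U_def by blast
    then show ?thesis
      unfolding \<Phi>'_def
      by (intro bounded_linear_Blinfun_apply bounded_linear_Pair bounded_linear_snd)
  qed
  have \<Phi>_deriv: "(\<Phi> has_derivative blinfun_apply (\<Phi>' p)) (at p)" if "p \<in> U" for p
    using that F'_W(1)[of p] unfolding \<Phi>'_apply[OF that] \<Phi>_def
    by (auto simp: U_def intro!: has_derivative_Pair has_derivative_snd)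
  have \<Phi>'_cont: "continuous_on U \<Phi>'"
  proof (rule continuous_on_blinfun_componentwise)
    fix v :: "real \<times> 'a"
    have "continuous_on U (\<lambda>p. (F' p v, snd v))"
      using cont_F'[of v] by (intro continuous_intros) (auto simp: U_def intro: continuous_on_subset)
    then show "continuous_on U (\<lambda>p. blinfun_apply (\<Phi>' p) v)"
      by (rule continuous_on_eq) (simp add: \<Phi>'_apply)
  qed
  \<comment> \<open>The inverse of the triangular map \<open>\<Phi>' (x0, y0)\<close>, found by
    solving for the first component; this is where \<open>d \<noteq> 0\<close> enters.\<close>
  define \<Psi> where "\<Psi> = Blinfun (\<lambda>v. ((fst v - F' (x0, y0) (0, snd v)) / d, snd v))"
  have "bounded_linear (F' (x0, y0))"
    using F'_W(1)[OF W(2)] has_derivative_bounded_linear by blast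
  then have "bounded_linear (\<lambda>v. F' (x0, y0) (0, snd v))"
    by (rule bounded_linear_compose)
      (intro bounded_linear_Pair bounded_linear_zero bounded_linear_snd)
  then have \<Psi>_apply: "blinfun_apply \<Psi> = (\<lambda>v. ((fst v - F' (x0, y0) (0, snd v)) / d, snd v))"
    unfolding \<Psi>_def divide_inverse
    by (intro bounded_linear_Blinfun_apply bounded_linear_Pair bounded_linear_mult_const
        bounded_linear_sub bounded_linear_fst bounded_linear_snd)
  have "\<Psi> o\<^sub>L \<Phi>' (x0, y0) = id_blinfun"
  proof (rule blinfun_eqI)
    fix v
    show "blinfun_apply (\<Psi> o\<^sub>L \<Phi>' (x0, y0)) v = blinfun_apply id_blinfun v"
      using \<open>F' (x0, y0) (1, 0) = d\<close> \<open>d \<noteq> 0\<close> split[OF W(2), of v] \<open>(x0, y0) \<in> U\<close>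
      by (simp add: \<Psi>_apply \<Phi>'_apply)
  qed
  from inverse_function_theorem[OF \<open>open U\<close> \<Phi>_deriv \<Phi>'_cont \<open>(x0, y0) \<in> U\<close> this]
  obtain U' V g g' where U': "open U'" "U' \<subseteq> U" "(x0, y0) \<in> U'" and V: "open V" "\<Phi> (x0, y0) \<in> V"
    and hom: "homeomorphism U' V \<Phi> g" and g': "\<And>y. y \<in> V \<Longrightarrow> (g has_derivative g' y) (at y)"
    by metis
  have \<Phi>g: "y \<in> V \<Longrightarrow> \<Phi> (g y) = y" "y \<in> V \<Longrightarrow> g y \<in> U'" "p \<in> U' \<Longrightarrow> g (\<Phi> p) = p" for y p
    using hom by (auto simp: homeomorphism_def)
  define k where "k y = fst (g (0, y))" for y
  define V' where "V' = (\<lambda>y. (0, y)) -` V"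
  have V': "open V'" "y0 \<in> V'"
    unfolding V'_def using V assms(2)
    by (auto simp: \<Phi>_def intro!: open_vimage continuous_intros)
  have g_eq: "g (0, y) = (k y, y)" if "y \<in> V'" for y
    using \<Phi>g(1)[of "(0, y)"] that by (simp add: V'_def \<Phi>_def k_def prod_eq_iff)
  have F_k: "F (k y, y) = 0" and k_in: "(k y, y) \<in> U" if "y \<in> V'" for y
    using \<Phi>g(1,2)[of "(0, y)"] that U'(2) g_eq[OF that] by (auto simp: V'_def \<Phi>_def)
  have k_unique: "fst p = k (snd p)" if "p \<in> U'" "F p = 0" for p
    using \<Phi>g(3)[OF that(1)] that(2) by (simp add: k_def \<Phi>_def)
  \<comment> \<open>Obtained by differentiating \<open>F (k y, y) = 0\<close> and solving for the
    derivative of \<open>k\<close>.\<close>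
  define k' where "k' y v = (- 1) *\<^sub>R (inverse (F' (k y, y) (1, 0)) *\<^sub>R F' (k y, y) (0, v))" for y v
  have k': "(k has_derivative k' y) (at y)" if "y \<in> V'" for y
  proof -
    have "((\<lambda>y. (0, y)) has_derivative (\<lambda>v. (0, v))) (at y)"
      by (auto intro!: derivative_eq_intros)
    moreover have "(g has_derivative g' (0, y)) (at (0, y))"
      using g' that by (simp add: V'_def)
    ultimately have "((\<lambda>y. g (0, y)) has_derivative (\<lambda>v. g' (0, y) (0, v))) (at y)"
      by (rule has_derivative_compose)
    then have k: "(k has_derivative (\<lambda>v. fst (g' (0, y) (0, v)))) (at y)"
      unfolding k_def by (rule has_derivative_fst)
    then have "((\<lambda>y. (k y, y)) has_derivative (\<lambda>v. (fst (g' (0, y) (0, v)), v))) (at y)"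
      by (auto intro!: derivative_eq_intros)
    moreover have "(F has_derivative F' (k y, y)) (at (k y, y))"
      using k_in[OF that] F'_W(1) U_def by blast
    ultimately have "((\<lambda>y. F (k y, y)) has_derivative
        (\<lambda>v. F' (k y, y) (fst (g' (0, y) (0, v)), v))) (at y)"
      by (rule has_derivative_compose)
    moreover have "((\<lambda>y. F (k y, y)) has_derivative (\<lambda>v. 0)) (at y)"
      by (rule has_derivative_transform_within_open[OF has_derivative_const[of 0] V'(1) that])
        (simp add: F_k)
    ultimately have "(\<lambda>v. F' (k y, y) (fst (g' (0, y) (0, v)), v)) = (\<lambda>v. 0)"
      by (rule has_derivative_unique)
    then have "F' (k y, y) (fst (g' (0, y) (0, v)), v) = 0" for v
      by (rule fun_cong)
    then have "F' (k y, y) (1, 0) * fst (g' (0, y) (0, v)) + F' (k y, y) (0, v) = 0" for v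
      using split[of "(k y, y)" "(fst (g' (0, y) (0, v)), v)"] k_in[OF that] by (simp add: U_def)
    then have "fst (g' (0, y) (0, v)) = k' y v" for v
      using k_in[OF that] by (simp add: U_def k'_def field_simps eq_neg_iff_add_eq_0)
    with k show ?thesis
      by simp
  qed
  \<comment> \<open>Bootstrap: the formula for \<open>k'\<close> involves \<open>k\<close> only
    through smooth functions, so each order of differentiability of \<open>k\<close> passes to
    \<open>k'\<close> and raises that of \<open>k\<close> by one.\<close>
  have "times_differentiable_on n V' k" for n
  proof (induction n)
    case (Suc n)
    have pair: "times_differentiable_on n V' (\<lambda>y. (k y, y))"
      using Suc times_differentiable_on_Pair times_differentiable_on_bounded_linear[OF bounded_linear_ident]
      by blast
    have comp: "times_differentiable_on n V' (\<lambda>y. F' (k y, y) v)" for v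
      using times_differentiable_on_compose[OF pair F'_W(2)] k_in U_def by blast
    have "times_differentiable_on n V' (\<lambda>y. inverse (F' (k y, y) (1, 0)))"
      using times_differentiable_on_inverse[OF comp] k_in U_def by blast
    then have "times_differentiable_on n V' (\<lambda>y. k' y v)" for v
      unfolding k'_def
      by (intro times_differentiable_on_scaleR times_differentiable_on_const comp)
    with k' show ?case
      by (rule times_differentiable_on_SucI)
  qed simp
  then have "smooth_near k y0"
    unfolding smooth_near_iff_times_differentiable using V' by blast
  moreover have "k y0 = x0"
    using k_unique[OF U'(3)] assms(2) by simp
  moreover have "\<forall>\<^sub>F y in nhds y0. F (k y, y) = 0"
    unfolding eventually_nhds using V' F_k by blast
  moreover have "\<forall>\<^sub>F p in nhds (x0, y0). F p = 0 \<longrightarrow> fst p = k (snd p)"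
    unfolding eventually_nhds using U' k_unique by blast
  ultimately show ?thesis
    using that by blast
qed

section \<open>Recognising cuspidal cross caps\<close>

lemma eventually_nhds_smooth_compose:
  assumes "smooth_near m p" "m p = q" "\<forall>\<^sub>F y in nhds q. P y"
  shows "\<forall>\<^sub>F x in nhds p. P (m x)"
  using smooth_near_tendsto[OF assms(1)] assms(2,3) by (auto dest: eventually_compose_filterlim)

text \<open>On the image of the germ the second coordinate minus \<^term>\<open>g u\<close> equals \<^term>\<open>v^2\<close>, so
  every even power of \<^term>\<open>v\<close> in the third coordinate can be removed by a change of the target,
  and \<^term>\<open>b u + v^2 * e (u, v^2)\<close> serves as a new first coordinate in source and target alike.\<close>

lemma cuspidal_cross_cap_of_transversal_zero:
  fixes g h a b :: "real \<Rightarrow> real" and c e :: "real \<times> real \<Rightarrow> real"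
  assumes g: "smooth_near g u0" and h: "smooth_near h u0" and a: "smooth_near a u0"
    and b: "smooth_near b u0" and c: "smooth_near c (u0, 0)" and e: "smooth_near e (u0, 0)"
    and b0: "b u0 = 0" and b': "(b has_real_derivative d) (at u0)" "d \<noteq> 0"
  shows "cuspidal_cross_cap_at (\<lambda>(u, v). (u, g u + v^2,
           h u + v^2 * (a u + v * b u + v^2 * c (u, v^2) + v^3 * e (u, v^2)))) (u0, 0)"
proof -
  note smooth = smooth_near_intros smooth_near_compose[OF g] smooth_near_compose[OF h]
    smooth_near_compose[OF a] smooth_near_compose[OF b] smooth_near_compose[OF c]
    smooth_near_compose[OF e]
  \<comment> \<open>The argument is \<open>(u, y, z)\<close>: the equation says that
    \<open>y\<close> is the new first coordinate at \<open>u\<close>, with \<open>z\<close> in the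
    place of \<open>v^2\<close>. Its solution \<open>k (y, z)\<close> recovers the old coordinate
    \<open>u\<close>.\<close>
  define F where "F = (\<lambda>p :: real \<times> real \<times> real.
    b (fst p) + snd (snd p) * e (fst p, snd (snd p)) - fst (snd p))"
  have "smooth_near F (u0, 0, 0)"
    unfolding F_def by (intro smooth) auto
  moreover have "F (u0, 0, 0) = 0"
    by (simp add: F_def b0)
  moreover have "((\<lambda>x. F (x, 0, 0)) has_real_derivative d) (at u0)"
    using b'(1) by (simp add: F_def)
  ultimately obtain k where k: "smooth_near k (0, 0)" and k0: "k (0, 0) = u0"
    and Fk: "\<forall>\<^sub>F y in nhds (0, 0). F (k y, y) = 0"
    and kF: "\<forall>\<^sub>F p in nhds (u0, 0, 0). F p = 0 \<longrightarrow> fst p = k (snd p)"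
    using b'(2) by (rule smooth_implicit_function)
  note smooth = smooth smooth_near_compose[OF k]
  define \<sigma> where "\<sigma> = (\<lambda>x :: real \<times> real. (k (fst x, snd x ^ 2), snd x))"
  define \<sigma>' where "\<sigma>' = (\<lambda>x :: real \<times> real. (b (fst x) + snd x ^ 2 * e (fst x, snd x ^ 2), snd x))"
  \<comment> \<open>With \<open>z\<close> the second coordinate minus \<open>g u\<close>, the third
    component subtracts \<open>h u\<close>, \<open>z * a u\<close> and
    \<open>z^2 * c (u, z)\<close>, and the first is \<open>b u + z * e (u, z)\<close>. The map
    \<open>\<tau>'\<close> undoes this by writing \<open>u = k (y, z)\<close>.\<close>
  define \<tau> where "\<tau> = (\<lambda>x :: real \<times> real \<times> real.
    (b (fst x) + (fst (snd x) - g (fst x)) * e (fst x, fst (snd x) - g (fst x)),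
     fst (snd x) - g (fst x),
     snd (snd x) - h (fst x) - (fst (snd x) - g (fst x)) * a (fst x)
       - (fst (snd x) - g (fst x))^2 * c (fst x, fst (snd x) - g (fst x))))"
  define \<tau>' where "\<tau>' = (\<lambda>x :: real \<times> real \<times> real.
    (k (fst x, fst (snd x)), fst (snd x) + g (k (fst x, fst (snd x))),
     snd (snd x) + h (k (fst x, fst (snd x))) + fst (snd x) * a (k (fst x, fst (snd x)))
       + fst (snd x) ^ 2 * c (k (fst x, fst (snd x)), fst (snd x))))"
  have sm: "smooth_near \<sigma> (0, 0)" "smooth_near \<sigma>' (u0, 0)"
    "smooth_near \<tau> (u0, g u0, h u0)" "smooth_near \<tau>' (0, 0, 0)"
    unfolding \<sigma>_def \<sigma>'_def \<tau>_def \<tau>'_def by (intro smooth; simp add: k0)+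
  have Fk_even: "\<forall>\<^sub>F x in nhds (0, 0). F (k (fst x, snd x ^ 2), fst x, snd x ^ 2) = 0"
    by (rule eventually_nhds_smooth_compose[OF _ _ Fk, where m = "\<lambda>x. (fst x, snd x ^ 2)"])
      ((intro smooth)?; simp)+
  have "diffeo_germ \<sigma> (0, 0) (u0, 0)"
    unfolding diffeo_germ_def
  proof (intro conjI exI[of _ \<sigma>'])
    show "\<forall>\<^sub>F x in nhds (0, 0). \<sigma>' (\<sigma> x) = x"
      using Fk_even by eventually_elim (simp add: \<sigma>_def \<sigma>'_def F_def prod_eq_iff)
    \<comment> \<open>One composite is the identity because \<open>k\<close> solves the equation;
      the other needs the uniqueness of the solution, \<open>kF\<close>. The same division of labour
      occurs for \<open>\<tau>\<close>.\<close>
    have "\<forall>\<^sub>F x in nhds (u0, 0).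
        F (fst x, b (fst x) + snd x ^ 2 * e (fst x, snd x ^ 2), snd x ^ 2) = 0 \<longrightarrow>
        fst x = k (b (fst x) + snd x ^ 2 * e (fst x, snd x ^ 2), snd x ^ 2)"
      by (rule eventually_nhds_smooth_compose[OF _ _ kF, where
            m = "\<lambda>x. (fst x, b (fst x) + snd x ^ 2 * e (fst x, snd x ^ 2), snd x ^ 2)",
            unfolded fst_conv snd_conv]) ((intro smooth)?; simp add: b0)+
    then show "\<forall>\<^sub>F y in nhds (u0, 0). \<sigma> (\<sigma>' y) = y"
      by eventually_elim (simp add: \<sigma>_def \<sigma>'_def F_def prod_eq_iff)
  qed (use sm k0 b0 in \<open>auto simp: \<sigma>_def \<sigma>'_def\<close>)
  moreover have "diffeo_germ \<tau> (u0, g u0, h u0) (0, 0, 0)"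
    unfolding diffeo_germ_def
  proof (intro conjI exI[of _ \<tau>'])
    have "\<forall>\<^sub>F x in nhds (0 :: real, 0 :: real, 0 :: real). F (k (fst x, fst (snd x)), fst x, fst (snd x)) = 0"
      by (rule eventually_nhds_smooth_compose[OF _ _ Fk, where m = "\<lambda>x :: real \<times> real \<times> real. (fst x, fst (snd x))"])
        ((intro smooth)?; simp)+
    then show "\<forall>\<^sub>F y in nhds (0, 0, 0). \<tau> (\<tau>' y) = y"
      by eventually_elim (simp add: \<tau>_def \<tau>'_def F_def prod_eq_iff)
    have "\<forall>\<^sub>F x in nhds (u0, g u0, h u0). F (fst x, fst (\<tau> x), fst (snd (\<tau> x))) = 0 \<longrightarrow>
        fst x = k (fst (\<tau> x), fst (snd (\<tau> x)))"
      by (rule eventually_nhds_smooth_compose[OF _ _ kF, where m = "\<lambda>x. (fst x, fst (\<tau> x), fst (snd (\<tau> x)))",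
            unfolded fst_conv snd_conv]) (intro smooth sm(3), simp add: b0 \<tau>_def)
    then show "\<forall>\<^sub>F x in nhds (u0, g u0, h u0). \<tau>' (\<tau> x) = x"
      by eventually_elim (simp add: \<tau>_def \<tau>'_def F_def prod_eq_iff)
  qed (use sm k0 b0 in \<open>auto simp: \<tau>_def \<tau>'_def\<close>)
  moreover have "\<forall>\<^sub>F x in nhds (0, 0). \<tau> ((\<lambda>(u, v). (u, g u + v^2,
      h u + v^2 * (a u + v * b u + v^2 * c (u, v^2) + v^3 * e (u, v^2)))) (\<sigma> x)) = ccr_std x"
    using Fk_even
  proof eventually_elim
    case (elim x)
    define X where "X = k (fst x, snd x ^ 2)"
    have b_X: "b X + snd x ^ 2 * e (X, snd x ^ 2) = fst x"
      using elim by (simp add: F_def X_def)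
    \<comment> \<open>Once the even terms are removed, \<open>v^3 * (b X + v^2 * e (X, v^2))\<close>
      remains, and the bracket is the new first coordinate.\<close>
    have "snd x ^ 2 * (a X + snd x * b X + snd x ^ 2 * c (X, snd x ^ 2) + snd x ^ 3 * e (X, snd x ^ 2))
        - snd x ^ 2 * a X - (snd x ^ 2)^2 * c (X, snd x ^ 2) = snd x ^ 3 * fst x"
      unfolding b_X[symmetric] by algebra
    with b_X show ?case
      unfolding \<sigma>_def X_def[symmetric] by (simp add: \<tau>_def ccr_std_def case_prod_beta)
  qed
  ultimately show ?thesis
    unfolding cuspidal_cross_cap_at_def A_equiv_def
    by (intro exI[of _ \<sigma>] exI[of _ \<tau>]) (simp add: ccr_std_def)
qed

section \<open>Local estimates\<close>

lemma eventually_nhds_Pair_real: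
  fixes a b :: real
  assumes "\<forall>\<^sub>F p in nhds (a, b). P p"
  obtains r where "r > 0" "\<And>x y. \<bar>x - a\<bar> < r \<Longrightarrow> \<bar>y - b\<bar> < r \<Longrightarrow> P (x, y)"
proof -
  obtain Q R where "\<forall>\<^sub>F x in nhds a. Q x" "\<forall>\<^sub>F y in nhds b. R y" "\<And>x y. Q x \<Longrightarrow> R y \<Longrightarrow> P (x, y)"
    using assms unfolding nhds_prod eventually_prod_filter by blast
  then obtain q r where "q > 0" "r > 0" "\<And>x. \<bar>x - a\<bar> < q \<Longrightarrow> Q x" "\<And>y. \<bar>y - b\<bar> < r \<Longrightarrow> R y"
    unfolding eventually_nhds_metric dist_real_def by blast
  then show ?thesis
    using that[of "min q r"] \<open>\<And>x y. Q x \<Longrightarrow> R y \<Longrightarrow> P (x, y)\<close> by simp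
qed

text \<open>The linear part contributes its bound \<open>K\<close>, and differentiability with
  tolerance 1 bounds the remainder, whence the constant \<open>K + 1\<close>.\<close>

lemma smooth_near_difference_bigo:
  fixes f :: "'a::real_normed_vector \<Rightarrow> real"
  assumes "smooth_near f a"
  shows "(\<lambda>x. f x - f a) \<in> O[nhds a](\<lambda>x. norm (x - a))"
proof -
  obtain U where U: "a \<in> U" "times_differentiable_on (Suc 0) U f"
    using assms unfolding smooth_near_iff_times_differentiable by blast
  then obtain f' where f': "(f has_derivative f') (at a)"
    by auto
  then obtain K where K: "\<And>h. norm (f' h) \<le> norm h * K"
    using bounded_linear.bounded[OF has_derivative_bounded_linear] by blast
  obtain r where r: "r > 0" "\<And>x. norm (x - a) < r \<Longrightarrow> norm (f x - f a - f' (x - a)) \<le> norm (x - a)"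
    using f' unfolding has_derivative_at_alt by (metis mult_1 zero_less_one)
  have "\<bar>f x - f a\<bar> \<le> (K + 1) * norm (x - a)" if "dist x a < r" for x
    using r(2)[of x] K[of "x - a"] that by (auto simp: dist_norm algebra_simps)
  then show ?thesis
    using r(1) by (intro bigoI[of _ "K + 1"]) (auto simp: eventually_nhds_metric)
qed

lemma smooth_near_deriv:
  fixes f :: "real \<Rightarrow> real"
  assumes "smooth_near f a"
  shows "smooth_near (deriv f) a"
    and "\<forall>\<^sub>F x in nhds a. (f has_real_derivative deriv f x) (at x)"
proof -
  obtain U where U: "open U" "a \<in> U" and f: "\<And>k. times_differentiable_on k U f"
    using assms unfolding smooth_near_iff_times_differentiable by blast
  note f' = times_differentiable_on_frechet_derivative[OF U(1) f]
  have *: "(f has_real_derivative frechet_derivative f (at x) 1) (at x)" if "x \<in> U" for x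
  proof -
    have "frechet_derivative f (at x) = (*) (frechet_derivative f (at x) 1)"
    proof
      fix h
      show "frechet_derivative f (at x) h = frechet_derivative f (at x) 1 * h"
        using linear_scale[OF has_derivative_linear[OF f'(1)[OF that]], of h 1] by simp
    qed
    then show ?thesis
      using f'(1)[OF that] unfolding has_field_derivative_def by metis
  qed
  then have deriv: "frechet_derivative f (at x) 1 = deriv f x" if "x \<in> U" for x
    using that DERIV_imp_deriv by metis
  have "times_differentiable_on k U (deriv f)" for k
    by (rule times_differentiable_on_cong[OF U(1) deriv f'(2)])
  with U show "smooth_near (deriv f) a"
    unfolding smooth_near_iff_times_differentiable by blast
  show "\<forall>\<^sub>F x in nhds a. (f has_real_derivative deriv f x) (at x)"
    unfolding eventually_nhds using U * deriv by metis
qed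

text \<open>The mean value inequality is applied to \<open>f z - deriv f a * z\<close>, whose
  derivative \<open>deriv f z - deriv f a\<close> is bounded by a multiple of the distance to
  \<open>a\<close> because \<open>deriv f\<close> is itself smooth.\<close>

lemma smooth_near_taylor1_bigo:
  fixes f :: "real \<Rightarrow> real"
  assumes "smooth_near f a"
  shows "(\<lambda>x. f x - f a - deriv f a * (x - a)) \<in> O[nhds a](\<lambda>x. (x - a)^2)"
proof -
  obtain K where K: "\<forall>\<^sub>F x in nhds a. norm (deriv f x - deriv f a) \<le> K * norm (norm (x - a))"
    using smooth_near_difference_bigo[OF smooth_near_deriv(1)[OF assms]] by (elim landau_o.bigE)
  obtain r where r: "r > 0" "\<And>x. \<bar>x - a\<bar> < r \<Longrightarrow> (f has_real_derivative deriv f x) (at x) \<and>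
      \<bar>deriv f x - deriv f a\<bar> \<le> K * \<bar>x - a\<bar>"
    using eventually_conj[OF smooth_near_deriv(2)[OF assms] K]
    by (auto simp: eventually_nhds_metric dist_real_def)
  have "\<bar>f x - f a - deriv f a * (x - a)\<bar> \<le> \<bar>K\<bar> * (x - a)^2" if x: "\<bar>x - a\<bar> < r" for x
  proof -
    let ?g = "\<lambda>z. f z - deriv f a * z"
    have "norm (?g x - ?g a) \<le> (\<bar>K\<bar> * \<bar>x - a\<bar>) * norm (x - a)"
    proof (rule field_differentiable_bound)
      show "convex (cball a \<bar>x - a\<bar>)"
        by simp
      fix z assume "z \<in> cball a \<bar>x - a\<bar>"
      then have z: "\<bar>z - a\<bar> \<le> \<bar>x - a\<bar>"
        by (simp add: dist_real_def abs_minus_commute)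
      with r(2)[of z] x have der: "(f has_real_derivative deriv f z) (at z)"
        and bound: "\<bar>deriv f z - deriv f a\<bar> \<le> K * \<bar>z - a\<bar>"
        by auto
      show "(?g has_real_derivative deriv f z - deriv f a) (at z within cball a \<bar>x - a\<bar>)"
        by (auto intro!: derivative_eq_intros has_field_derivative_at_within[OF der])
      have "K * \<bar>z - a\<bar> \<le> \<bar>K\<bar> * \<bar>x - a\<bar>"
        using z by (intro mult_mono) auto
      with bound show "norm (deriv f z - deriv f a) \<le> \<bar>K\<bar> * \<bar>x - a\<bar>"
        by simp
    qed (auto simp: dist_real_def)
    moreover have "?g x - ?g a = f x - f a - deriv f a * (x - a)"
      by (simp add: algebra_simps)
    ultimately show ?thesis
      by (simp add: power2_eq_square mult.assoc)
  qed
  then show ?thesis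
    using r(1) by (intro bigoI[of _ "\<bar>K\<bar>"]) (auto simp: eventually_nhds_metric dist_real_def)
qed

lemma smooth_near_bigo_1:
  fixes f :: "'a::real_normed_vector \<Rightarrow> real"
  assumes "smooth_near f a"
  shows "f \<in> O[nhds a](\<lambda>_. 1)"
proof (rule bigoI)
  have "\<forall>\<^sub>F x in nhds a. dist (f x) (f a) < 1"
    using tendstoD[OF smooth_near_tendsto[OF assms], of 1] by simp
  then show "\<forall>\<^sub>F x in nhds a. norm (f x) \<le> (\<bar>f a\<bar> + 1) * norm (1 :: real)"
    by eventually_elim (auto simp: dist_real_def)
qed

text \<open>By the mean value theorem; it turns a small value of \<open>F\<close> at an approximate
  root into closeness to the true root.\<close>

lemma abs_diff_ge_of_derivative_ge:
  fixes f f' :: "real \<Rightarrow> real"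
  assumes "\<And>z. \<bar>z - c\<bar> < r \<Longrightarrow> (f has_real_derivative f' z) (at z)"
    and "\<And>z. \<bar>z - c\<bar> < r \<Longrightarrow> m \<le> f' z" and "m \<ge> 0" "\<bar>x - c\<bar> < r" "\<bar>y - c\<bar> < r"
  shows "m * \<bar>x - y\<bar> \<le> \<bar>f x - f y\<bar>"
proof -
  have *: "m * (v - u) \<le> f v - f u" if "u < v" "\<bar>u - c\<bar> < r" "\<bar>v - c\<bar> < r" for u v
  proof -
    have "\<bar>z - c\<bar> < r" if "u \<le> z" "z \<le> v" for z
      using that \<open>\<bar>u - c\<bar> < r\<close> \<open>\<bar>v - c\<bar> < r\<close> by linarith
    moreover from this obtain z where "u < z" "z < v" "f v - f u = (v - u) * f' z"
      using MVT2[OF \<open>u < v\<close>, of f f'] assms(1) by blast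
    ultimately show ?thesis
      using assms(2)[of z] \<open>u < v\<close> by (simp add: mult.commute[of m] mult_left_mono)
  qed
  consider "x < y" | "x = y" | "y < x"
    by linarith
  then show ?thesis
    using *[of x y] *[of y x] assms(4,5) by cases auto
qed

section \<open>The bifurcation of cuspidal cross caps\<close>

theorem theorem4p1:
  fixes f :: "real \<Rightarrow> real \<Rightarrow> real \<Rightarrow> real \<times> real \<times> real"
    and f21 f31 :: "real \<Rightarrow> real"
    and f24 f34 c0 c1 :: "real \<times> real \<Rightarrow> real"
    and c2 c3 :: "real \<times> real \<times> real \<Rightarrow> real"
    and d1 d2 d3 :: "real \<Rightarrow> real"
    and d4 :: "real \<times> real \<Rightarrow> real"
  assumes f_def: "\<And>u v s. f u v s =
      (u,
       u^2 * f21 u + v^2 + u * s * f24 (u, s),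
       u^2 * f31 u
         + v^2 * (c0 (u, s) + v * c1 (u, s) + v^2 * c2 (u, v^2, s) + v^3 * c3 (u, v^2, s))
         + u * s * f34 (u, s))"
    and sm_f21: "smooth_near f21 0" and sm_f31: "smooth_near f31 0"
    and sm_f24: "smooth_near f24 (0, 0)" and sm_f34: "smooth_near f34 (0, 0)"
    and sm_c0: "smooth_near c0 (0, 0)" and sm_c1: "smooth_near c1 (0, 0)"
    and sm_c2: "smooth_near c2 (0, 0, 0)" and sm_c3: "smooth_near c3 (0, 0, 0)"
    and sm_d1: "smooth_near d1 0" and sm_d2: "smooth_near d2 0"
    and sm_d3: "smooth_near d3 0" and sm_d4: "smooth_near d4 (0, 0)"
    and c0_0: "c0 (0, 0) = 0"
    and c1_eq: "\<And>u s. c1 (u, s) = s + u * s * d1 s + u^2 * d2 s + u^3 * d3 s + u^4 * d4 (u, s)"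
    and d2_pos: "d2 0 > 0"
  shows "\<exists>ut :: real \<Rightarrow> real.
     smooth_near ut 0 \<and>
     (let D = sqrt (d2 0) in
        \<exists>C \<delta>. \<delta> > 0 \<and> (\<forall>t. \<bar>t\<bar> < \<delta> \<longrightarrow>
          \<bar>ut t - ((1 / D) * t
                   + (d1 0 * D^2 - d3 0) / (2 * D^4) * t^2
                   + ((d1 0 ^ 2 + 4 * deriv d2 0) * D^4
                      - 2 * (3 * d1 0 * d3 0 + 2 * d4 (0, 0)) * D^2
                      + 5 * d3 0 ^ 2) / (8 * D^7) * t^3)\<bar> \<le> C * t^4)) \<and>
     (\<exists>\<epsilon> > 0. \<exists>\<delta> > 0. \<forall>t. \<bar>t\<bar> < \<delta> \<longrightarrow>
        {p :: real \<times> real. p \<in> ball (0, 0) \<epsilon> \<and> snd p = 0 \<and> c1 (fst p, - (t^2)) = 0}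
          = {(ut t, 0), (ut (- t), 0)}) \<and>
     (\<exists>\<delta> > 0. \<forall>t. t \<noteq> 0 \<and> \<bar>t\<bar> < \<delta> \<longrightarrow>
        cuspidal_cross_cap_at (\<lambda>(u, v). f u v (- (t^2))) (ut t, 0) \<and>
        cuspidal_cross_cap_at (\<lambda>(u, v). f u v (- (t^2))) (ut (- t), 0))"
proof -

  \<comment> \<open>The rescaled root equation and its smooth solution\<close>
  define D where "D = sqrt (d2 0)"
  have D: "D > 0" "d2 0 = D^2"
    using d2_pos by (auto simp: D_def)
  \<comment> \<open>The factor \<open>t^2\<close> is cancelled by hand, so \<open>F\<close> is also
    defined and smooth at \<open>t = 0\<close>.\<close>
  define F where "F = (\<lambda>p :: real \<times> real. - 1 - fst p * snd p * d1 (- (snd p ^ 2))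
    + fst p ^ 2 * d2 (- (snd p ^ 2)) + fst p ^ 3 * snd p * d3 (- (snd p ^ 2))
    + fst p ^ 4 * snd p ^ 2 * d4 (snd p * fst p, - (snd p ^ 2)))"
  have c1_F: "c1 (t * x, - (t^2)) = t^2 * F (x, t)" for x t
    unfolding c1_eq F_def by (simp add: algebra_simps power_numeral_reduce)
  note smooth_d = smooth_near_compose[OF sm_d1] smooth_near_compose[OF sm_d2]
    smooth_near_compose[OF sm_d3] smooth_near_compose[OF sm_d4]
  have smooth_F: "smooth_near F (1 / D, 0)"
    unfolding F_def by (intro smooth_near_intros smooth_d) auto
  \<comment> \<open>At \<open>t = 0\<close> the equation is \<open>D^2 * x^2 = 1\<close>. Only its
    positive root is continued; the branch of the negative one is reached by changing the sign of
    \<open>t\<close>.\<close>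
  have F0: "F (1 / D, 0) = 0"
    using D by (simp add: F_def power_divide)
  have F'0: "((\<lambda>x. F (x, 0)) has_real_derivative 2 * D) (at (1 / D))"
    using D by (auto simp: F_def power2_eq_square intro!: derivative_eq_intros)
  have "2 * D \<noteq> 0"
    using D by simp
  with smooth_F F0 F'0 obtain w where w: "smooth_near w 0" "w 0 = 1 / D"
    and F_w: "\<forall>\<^sub>F t in nhds 0. F (w t, t) = 0"
    and w_unique: "\<forall>\<^sub>F p in nhds (1 / D, 0). F p = 0 \<longrightarrow> fst p = w (snd p)"
    by (rule smooth_implicit_function)
  obtain G where G: "smooth_near G (1 / D, 0)"
    "\<forall>\<^sub>F q in nhds (1 / D, 0). ((\<lambda>x. F (x, snd q)) has_real_derivative G q) (at (fst q))"
    using smooth_near_partial_derivative[OF smooth_F] .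
  have "G (1 / D, 0) = 2 * D"
    using DERIV_unique[OF F'0] eventually_nhds_x_imp_x[OF G(2)] by simp
  \<comment> \<open>The threshold \<open>D\<close> is half of the value \<open>2 * D\<close> at the
    base point. It bounds the partial derivative below on a box of radius \<open>r\<close> on which
    the root is also unique.\<close>
  then have "\<forall>\<^sub>F q in nhds (1 / D, 0). D < G q"
    using order_tendstoD(1)[OF smooth_near_tendsto[OF G(1)], of D] D(1) by simp
  then have "\<forall>\<^sub>F q in nhds (1 / D, 0). D < G q \<and>
      ((\<lambda>x. F (x, snd q)) has_real_derivative G q) (at (fst q)) \<and> (F q = 0 \<longrightarrow> fst q = w (snd q))"
    using G(2) w_unique by eventually_elim simp
  then obtain r where r: "r > 0" and near:
    "\<And>x t. \<bar>x - 1 / D\<bar> < r \<Longrightarrow> \<bar>t - 0\<bar> < r \<Longrightarrow> D < G (x, t) \<and>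
      ((\<lambda>x. F (x, t)) has_real_derivative G (x, t)) (at x) \<and> (F (x, t) = 0 \<longrightarrow> x = w t)"
    by (rule eventually_nhds_Pair_real) simp
  have near_0: "\<forall>\<^sub>F t in nhds 0. \<bar>m t - m 0\<bar> < \<rho>"
    if "smooth_near m 0" "\<rho> > 0" for m :: "real \<Rightarrow> real" and \<rho>
    using tendstoD[OF smooth_near_tendsto[OF that(1)] that(2)] by (simp add: dist_real_def)
  have small: "\<forall>\<^sub>F t in nhds 0. \<bar>t\<bar> < \<rho>" if "\<rho> > 0" for \<rho> :: real
    using near_0[OF smooth_near_ident that] by simp
  have near_w: "\<forall>\<^sub>F t in nhds 0. \<bar>w t - 1 / D\<bar> < r"
    using near_0[OF w(1) r] w(2) by simp
  define ut where "ut t = t * w t" for t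
  have smooth_ut: "smooth_near ut 0"
    unfolding ut_def by (intro smooth_near_intros w)
  have ut0: "ut 0 = 0"
    by (simp add: ut_def)
  have reflect: "\<forall>\<^sub>F t in nhds 0. Q (- t)" if "\<forall>\<^sub>F t in nhds 0. Q t" for Q :: "real \<Rightarrow> bool"
    using eventually_nhds_smooth_compose[OF smooth_near_minus[OF smooth_near_ident] _ that] by simp
  have radius: "\<exists>\<delta>>0. \<forall>t. \<bar>t\<bar> < \<delta> \<longrightarrow> Q t" if "\<forall>\<^sub>F t in nhds 0. Q t" for Q :: "real \<Rightarrow> bool"
    using that by (auto simp: eventually_nhds_metric dist_real_def)

  \<comment> \<open>The expansion of the root up to order three\<close>
  define a b c where "a = 1 / D" and "b = (d1 0 * D^2 - d3 0) / (2 * D^4)"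
    and "c = ((d1 0 ^ 2 + 4 * deriv d2 0) * D^4 - 2 * (3 * d1 0 * d3 0 + 2 * d4 (0, 0)) * D^2
      + 5 * d3 0 ^ 2) / (8 * D^7)"
  \<comment> \<open>\<open>P\<close> approximates \<open>w\<close>, that is \<open>ut t / t\<close>,
    so the cubic claimed for \<open>ut\<close> becomes a quadratic here.\<close>
  define P where "P t = a + b * t + c * t^2" for t
  have smooth_P: "smooth_near P 0"
    unfolding P_def by (intro smooth_near_intros)
  have "\<exists>C \<delta>. \<delta> > 0 \<and> (\<forall>t. \<bar>t\<bar> < \<delta> \<longrightarrow> \<bar>ut t - (a * t + b * t^2 + c * t^3)\<bar> \<le> C * t^4)"
  proof -
    \<comment> \<open>\<open>e1\<close> to \<open>e4\<close> are Taylor remainders along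
      \<open>s = - (t^2)\<close>. Only \<open>d2\<close> is expanded to first order: it enters
      \<open>F\<close> without a factor \<open>t\<close>, so its \<open>t^2\<close> term affects the
      coefficient \<open>c\<close>.\<close>
    define e1 where "e1 t = d1 (- (t^2)) - d1 0" for t
    define e2 where "e2 t = d2 (- (t^2)) - d2 0 - deriv d2 0 * (- (t^2))" for t
    define e3 where "e3 t = d3 (- (t^2)) - d3 0" for t
    define e4 where "e4 t = d4 (t * P t, - (t^2)) - d4 (0, 0)" for t
    define q where "q t = b + c * t" for t
    \<comment> \<open>\<open>t^3 * R t\<close> gathers all terms of order at least three in
      \<open>F (P t, t)\<close> apart from the remainders, using
      \<open>P t = a + t * q t\<close>.\<close>
    define R where "R t = - c * d1 0 + (2 * b * c + c^2 * t) * D^2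
      - (2 * a * b + (b^2 + 2 * a * c) * t + t^2 * (2 * b * c + c^2 * t)) * deriv d2 0
      + (3 * a^2 * c + 3 * a * q t ^ 2 + t * q t ^ 3) * d3 0
      + q t * (4 * a^3 + 6 * a^2 * t * q t + 4 * a * t^2 * q t ^ 2 + t^3 * q t ^ 3) * d4 (0, 0)" for t
    \<comment> \<open>The three equations say that the coefficients of \<open>1\<close>,
      \<open>t\<close> and \<open>t^2\<close> in \<open>F (P t, t)\<close> vanish. Solved in turn,
      they determine \<open>a > 0\<close>, then \<open>b\<close>, then \<open>c\<close>.\<close>
    have coeff0: "a^2 * D^2 = 1"
      using D by (simp add: a_def power_divide)
    have coeff1: "- a * d1 0 + 2 * a * b * D^2 + a^3 * d3 0 = 0"
      using D by (simp add: a_def b_def field_simps power_numeral_reduce)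
    have coeff2: "- b * d1 0 + (b^2 + 2 * a * c) * D^2 - a^2 * deriv d2 0 + 3 * a^2 * b * d3 0
        + a^4 * d4 (0, 0) = 0"
      using D(1) by (simp add: a_def b_def c_def field_simps power_numeral_reduce)
    have F_P: "F (P t, t) = t^3 * R t - P t * t * e1 t + P t ^ 2 * e2 t + P t ^ 3 * t * e3 t
        + P t ^ 4 * t^2 * e4 t" for t
    proof -
      have "F (P t, t) = (a^2 * D^2 - 1) + t * (- a * d1 0 + 2 * a * b * D^2 + a^3 * d3 0)
          + t^2 * (- b * d1 0 + (b^2 + 2 * a * c) * D^2 - a^2 * deriv d2 0 + 3 * a^2 * b * d3 0
        + a^4 * d4 (0, 0)) + t^3 * R t - P t * t * e1 t + P t ^ 2 * e2 t + P t ^ 3 * t * e3 t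
        + P t ^ 4 * t^2 * e4 t"
        unfolding F_def e1_def e2_def e3_def e4_def R_def fst_conv snd_conv q_def P_def D(2)
        by algebra
      then show ?thesis
        unfolding coeff0 coeff1 coeff2 by simp
    qed
    have square: "((\<lambda>t :: real. - (t^2)) \<longlongrightarrow> 0) (nhds 0)"
      using smooth_near_tendsto[OF smooth_near_minus[OF smooth_near_power[OF smooth_near_ident]],
          of 2 "0 :: real"] by simp
    have e1: "e1 \<in> O[nhds 0](\<lambda>t. t^2)"
      using landau_o.big.compose[OF smooth_near_difference_bigo[OF sm_d1] square]
      by (simp add: e1_def[abs_def])
    have e3: "e3 \<in> O[nhds 0](\<lambda>t. t^2)"
      using landau_o.big.compose[OF smooth_near_difference_bigo[OF sm_d3] square]
      by (simp add: e3_def[abs_def])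
    have e2: "e2 \<in> O[nhds 0](\<lambda>t. t^4)"
      using landau_o.big.compose[OF smooth_near_taylor1_bigo[OF sm_d2] square]
      by (simp add: e2_def[abs_def])
    have e4: "e4 \<in> O[nhds 0](\<lambda>t. t)"
    proof -
      have "smooth_near (\<lambda>t. d4 (t * P t, - (t^2))) 0"
        by (intro smooth_d smooth_near_intros smooth_P) simp
      from smooth_near_difference_bigo[OF this] show ?thesis
        by (simp add: e4_def[abs_def])
    qed
    have P: "(\<lambda>t. P t ^ n) \<in> O[nhds 0](\<lambda>_. 1)" for n
      by (intro smooth_near_bigo_1 smooth_near_power smooth_P)
    have R: "R \<in> O[nhds 0](\<lambda>_. 1)"
      unfolding R_def q_def by (intro smooth_near_bigo_1 smooth_near_intros)
    have t: "(\<lambda>t. t ^ n) \<in> O[nhds 0](\<lambda>t. t ^ n)" for n :: nat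
      by simp
    have "(\<lambda>t. t^3 * R t) \<in> O[nhds 0](\<lambda>t. t^3)"
      using landau_o.big.mult[OF t[of 3] R] by simp
    moreover have "(\<lambda>t. P t * t * e1 t) \<in> O[nhds 0](\<lambda>t. t^3)"
      using landau_o.big.mult[OF landau_o.big.mult[OF P[of 1] t[of 1]] e1]
      by (simp add: power_numeral_reduce)
    moreover have "(\<lambda>t. P t ^ 3 * t * e3 t) \<in> O[nhds 0](\<lambda>t. t^3)"
      using landau_o.big.mult[OF landau_o.big.mult[OF P[of 3] t[of 1]] e3]
      by (simp add: power_numeral_reduce)
    moreover have "(\<lambda>t. P t ^ 4 * t^2 * e4 t) \<in> O[nhds 0](\<lambda>t. t^3)"
      using landau_o.big.mult[OF landau_o.big.mult[OF P[of 4] t[of 2]] e4]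
      by (simp add: power_numeral_reduce mult.assoc)
    moreover have "(\<lambda>t. P t ^ 2 * e2 t) \<in> O[nhds 0](\<lambda>t. t^3)"
    proof -
      have "(\<lambda>t. t) \<in> O[nhds 0](\<lambda>_. 1 :: real)"
        by (intro smooth_near_bigo_1 smooth_near_ident)
      from landau_o.big.mult[OF this t[of 3]] have "(\<lambda>t. t^4) \<in> O[nhds 0](\<lambda>t. t^3 :: real)"
        by (simp add: power_numeral_reduce)
      with landau_o.big.mult[OF P[of 2] e2] show ?thesis
        by (simp add: landau_o.big_trans)
    qed
    ultimately have "(\<lambda>t. F (P t, t)) \<in> O[nhds 0](\<lambda>t. t^3)"
      unfolding F_P by (intro sum_in_bigo)
    then obtain K where "\<forall>\<^sub>F t in nhds 0. norm (F (P t, t)) \<le> K * norm (t^3)"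
      by (elim landau_o.bigE)
    moreover have "\<forall>\<^sub>F t in nhds 0. \<bar>P t - 1 / D\<bar> < r"
      using near_0[OF smooth_P r] by (simp add: P_def a_def)
    \<comment> \<open>Both \<open>w t\<close> and \<open>P t\<close> lie in the window where the
      derivative of \<open>F\<close> is at least \<open>D\<close>, hence
      \<open>D * \<bar>w t - P t\<bar> \<le> K * \<bar>t\<bar>^3\<close>. The factor
      \<open>t\<close> in \<open>ut\<close> supplies the fourth power, and the constant is
      \<open>K / D\<close>.\<close>
    ultimately have "\<forall>\<^sub>F t in nhds 0.
        \<bar>ut t - (a * t + b * t^2 + c * t^3)\<bar> \<le> K / D * t^4"
      using F_w near_w small[OF r]
    proof eventually_elim
      case (elim t)
      have "D * \<bar>w t - P t\<bar> \<le> \<bar>F (w t, t) - F (P t, t)\<bar>"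
      proof (rule abs_diff_ge_of_derivative_ge)
        show "((\<lambda>x. F (x, t)) has_real_derivative G (z, t)) (at z)" "D \<le> G (z, t)"
          if "\<bar>z - 1 / D\<bar> < r" for z
          using near[OF that, of t] elim(5) by (simp_all add: less_imp_le)
      qed (use elim D(1) in auto)
      also have "\<dots> \<le> K * \<bar>t\<bar>^3"
        using elim by (simp add: power_abs)
      finally have "\<bar>t\<bar> * \<bar>w t - P t\<bar> \<le> \<bar>t\<bar> * (K * \<bar>t\<bar>^3 / D)"
        using D(1) by (intro mult_left_mono) (auto simp: field_simps)
      moreover have "ut t - (a * t + b * t^2 + c * t^3) = t * (w t - P t)"
        by (simp add: ut_def P_def algebra_simps power_numeral_reduce)
      moreover have "\<bar>t\<bar> * (K * \<bar>t\<bar>^3 / D) = K / D * t^4"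
        by (simp add: power_numeral_reduce)
      ultimately show ?case
        by (metis abs_mult)
    qed
    then show ?thesis
      using radius by blast
  qed

  \<comment> \<open>The zero set of \<open>c1\<close> near the origin\<close>
  moreover have "\<exists>\<epsilon>>0. \<exists>\<delta>>0. \<forall>t. \<bar>t\<bar> < \<delta> \<longrightarrow>
      {p :: real \<times> real. p \<in> ball (0, 0) \<epsilon> \<and> snd p = 0 \<and> c1 (fst p, - (t^2)) = 0}
        = {(ut t, 0), (ut (- t), 0)}"
  proof -
    \<comment> \<open>\<open>c1 (u, s) = s * N (u, s) + u^2 * M (u, s)\<close>, so a root at
      \<open>s = - (t^2)\<close> satisfies \<open>u^2 * M = t^2 * N\<close>. As \<open>N / M\<close>
      tends to \<open>1 / D^2\<close>, this forces \<open>\<bar>u / t\<bar>\<close> into the window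
      where the root of \<open>F\<close> is unique.\<close>
    define N where "N = (\<lambda>p. 1 + fst p * d1 (snd p))"
    define M where "M = (\<lambda>p. d2 (snd p) + fst p * d3 (snd p) + fst p ^ 2 * d4 (fst p, snd p))"
    have "smooth_near N (0, 0)" "smooth_near M (0, 0)"
      unfolding N_def M_def by (intro smooth_d smooth_near_intros; simp)+
    then have lim: "(N \<longlongrightarrow> 1) (nhds (0, 0))" "(M \<longlongrightarrow> D^2) (nhds (0, 0))"
      using smooth_near_tendsto[of N "(0, 0)"] smooth_near_tendsto[of M "(0, 0)"] D(2)
      by (auto simp: N_def M_def)
    have "((\<lambda>p. sqrt (N p / M p)) \<longlongrightarrow> sqrt (1 / D^2)) (nhds (0, 0))"
      using D(1) by (intro tendsto_intros lim) auto
    from tendstoD[OF this r] have "\<forall>\<^sub>F p in nhds (0, 0). \<bar>sqrt (N p / M p) - 1 / D\<bar> < r"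
      using D(1) by (simp add: real_sqrt_divide dist_real_def)
    moreover have "\<forall>\<^sub>F p in nhds (0, 0). M p > 0"
      using order_tendstoD(1)[OF lim(2)] D(1) by simp
    ultimately have "\<forall>\<^sub>F p in nhds (0, 0). \<bar>sqrt (N p / M p) - 1 / D\<bar> < r \<and> M p > 0"
      by eventually_elim simp
    then obtain \<rho> where \<rho>: "\<rho> > 0" and ratio: "\<And>u s. \<bar>u - 0\<bar> < \<rho> \<Longrightarrow> \<bar>s - 0\<bar> < \<rho> \<Longrightarrow>
        \<bar>sqrt (N (u, s) / M (u, s)) - 1 / D\<bar> < r \<and> M (u, s) > 0"
      by (rule eventually_nhds_Pair_real) simp
    have zero: "u = ut t \<or> u = ut (- t)"
      if u: "\<bar>u\<bar> < \<rho>" and t: "\<bar>- (t^2)\<bar> < \<rho>" "\<bar>t\<bar> < r" and c1: "c1 (u, - (t^2)) = 0" for u t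
    proof -
      let ?x = "sqrt (N (u, - (t^2)) / M (u, - (t^2)))"
      have x: "\<bar>?x - 1 / D\<bar> < r" and M: "M (u, - (t^2)) > 0"
        using ratio[of u "- (t^2)"] u t(1) by auto
      have "u^2 * M (u, - (t^2)) = t^2 * N (u, - (t^2))"
        using c1 unfolding c1_eq M_def N_def by (simp add: algebra_simps power_numeral_reduce)
      then have "u^2 = t^2 * (N (u, - (t^2)) / M (u, - (t^2)))"
        using M by (simp add: field_simps)
      then have "sqrt (u^2) = sqrt (t^2 * (N (u, - (t^2)) / M (u, - (t^2))))"
        by simp
      then have abs_u: "\<bar>u\<bar> = \<bar>t\<bar> * ?x"
        by (simp only: real_sqrt_mult real_sqrt_abs)
      \<comment> \<open>The sign of \<open>u\<close> is absorbed into \<open>\<tau> = t\<close> or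
        \<open>\<tau> = - t\<close>, which leaves \<open>s\<close> unchanged and keeps
        \<open>?x\<close> near the positive root. The case \<open>\<tau> = 0\<close> is separate
        because \<open>c1_F\<close> can be divided by \<open>\<tau>^2\<close> only
        otherwise.\<close>
      have root: "u = ut \<tau>" if "u = \<tau> * ?x" "\<bar>\<tau>\<bar> = \<bar>t\<bar>" for \<tau>
      proof (cases "\<tau> = 0")
        case False
        have "c1 (\<tau> * ?x, - (\<tau>^2)) = 0"
          using c1 that by (metis power2_abs)
        then have "F (?x, \<tau>) = 0"
          using False by (simp add: c1_F)
        then have "?x = w \<tau>"
          using near[OF x, of \<tau>] that(2) t(2) by simp
        with that(1) show ?thesis
          by (simp add: ut_def)
      qed (use that in \<open>simp add: ut_def\<close>)
      have "u = t * ?x \<or> u = - t * ?x"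
        using abs_u by (auto simp: abs_if split: if_splits)
      then show ?thesis
        using root[of t] root[of "- t"] by auto
    qed
    have c1_ut: "\<forall>\<^sub>F t in nhds 0. c1 (ut t, - (t^2)) = 0 \<and> \<bar>ut t\<bar> < \<rho>"
      using F_w near_0[OF smooth_ut \<rho>] by eventually_elim (simp add: ut_def c1_F)
    have "smooth_near (\<lambda>t :: real. - (t^2)) 0"
      by (intro smooth_near_intros)
    from near_0[OF this \<rho>] have "\<forall>\<^sub>F t in nhds 0. \<bar>- (t^2)\<bar> < \<rho>"
      by simp
    then have "\<forall>\<^sub>F t in nhds 0.
        {p :: real \<times> real. p \<in> ball (0, 0) \<rho> \<and> snd p = 0 \<and> c1 (fst p, - (t^2)) = 0}
          = {(ut t, 0), (ut (- t), 0)}"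
      using small[OF r] c1_ut reflect[OF c1_ut]
    proof eventually_elim
      case (elim t)
      have "{p :: real \<times> real. p \<in> ball (0, 0) \<rho> \<and> snd p = 0 \<and> c1 (fst p, - (t^2)) = 0}
          = (\<lambda>u. (u, 0)) ` {u. \<bar>u\<bar> < \<rho> \<and> c1 (u, - (t^2)) = 0}"
        by (auto simp: dist_Pair_Pair)
      also have "{u. \<bar>u\<bar> < \<rho> \<and> c1 (u, - (t^2)) = 0} = {ut t, ut (- t)}"
        using elim zero[of _ t] by auto
      finally show ?case
        by simp
    qed
    then show ?thesis
      using radius \<rho> by blast
  qed

  \<comment> \<open>Cuspidal cross caps at the two roots\<close>
  moreover have "\<exists>\<delta>>0. \<forall>t. t \<noteq> 0 \<and> \<bar>t\<bar> < \<delta> \<longrightarrow>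
      cuspidal_cross_cap_at (\<lambda>(u, v). f u v (- (t^2))) (ut t, 0) \<and>
      cuspidal_cross_cap_at (\<lambda>(u, v). f u v (- (t^2))) (ut (- t), 0)"
  proof -
    \<comment> \<open>Smoothness is assumed at the origin only. It is an open condition, so it
      persists at the nearby base points determined by \<open>ut t\<close> and
      \<open>- (t^2)\<close>.\<close>
    have smooth_1: "\<forall>\<^sub>F t in nhds 0. smooth_near \<phi> (ut t)" if "smooth_near \<phi> 0" for \<phi> :: "real \<Rightarrow> real"
      using eventually_nhds_smooth_compose[OF smooth_ut ut0 smooth_near_eventually[OF that]] .
    have smooth_2: "\<forall>\<^sub>F t in nhds 0. smooth_near \<phi> (ut t, - (t^2))"
      if "smooth_near \<phi> (0, 0)" for \<phi> :: "real \<times> real \<Rightarrow> real"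
      by (rule eventually_nhds_smooth_compose[OF _ _ smooth_near_eventually[OF that]])
        (intro smooth_near_intros smooth_ut, simp add: ut0)
    have smooth_3: "\<forall>\<^sub>F t in nhds 0. smooth_near \<phi> (ut t, 0, - (t^2))"
      if "smooth_near \<phi> (0, 0, 0)" for \<phi> :: "real \<times> real \<times> real \<Rightarrow> real"
      by (rule eventually_nhds_smooth_compose[OF _ _ smooth_near_eventually[OF that]])
        (intro smooth_near_intros smooth_ut, simp add: ut0)
    have ccc: "\<forall>\<^sub>F t in nhds 0. t \<noteq> 0 \<longrightarrow>
        cuspidal_cross_cap_at (\<lambda>(u, v). f u v (- (t^2))) (ut t, 0)"
      using smooth_1[OF sm_f21] smooth_1[OF sm_f31] smooth_2[OF sm_f24] smooth_2[OF sm_f34]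
        smooth_2[OF sm_c0] smooth_2[OF sm_c1] smooth_3[OF sm_c2] smooth_3[OF sm_c3]
        F_w near_w small[OF r]
    proof eventually_elim
      case (elim t)
      show ?case
      proof
        assume "t \<noteq> 0"
        define s where "s = - (t^2)"
        note smooth = smooth_near_intros elim(1,2)
          elim(3-8)[folded s_def, THEN smooth_near_compose]
        have G: "D < G (w t, t)" "((\<lambda>x. F (x, t)) has_real_derivative G (w t, t)) (at (w t))"
          using near[of "w t" t] elim by auto
        \<comment> \<open>Differentiating \<open>c1 (u, s) = t^2 * F (u / t, t)\<close> in
          \<open>u\<close> leaves one factor \<open>t\<close>; the zero is therefore transversal
          exactly because \<open>t \<noteq> 0\<close> and \<open>G (w t, t) > D\<close>.\<close>
        have "((\<lambda>u. c1 (u, s)) has_real_derivative t * G (w t, t)) (at (ut t))"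
        proof -
          have "((\<lambda>u. u / t) has_real_derivative 1 / t) (at (ut t))"
            using \<open>t \<noteq> 0\<close> by (auto intro!: derivative_eq_intros)
          moreover have "((\<lambda>x. F (x, t)) has_real_derivative G (w t, t)) (at (ut t / t))"
            using G(2) \<open>t \<noteq> 0\<close> by (simp add: ut_def)
          ultimately have "((\<lambda>u. F (u / t, t)) has_real_derivative G (w t, t) * (1 / t)) (at (ut t))"
            using DERIV_chain2 by fast
          then have "((\<lambda>u. t^2 * F (u / t, t)) has_real_derivative t^2 * (G (w t, t) * (1 / t)))
              (at (ut t))"
            by (rule DERIV_cmult)
          moreover have "(\<lambda>u. t^2 * F (u / t, t)) = (\<lambda>u. c1 (u, s))"
            using c1_F[of t "u / t" for u] \<open>t \<noteq> 0\<close> by (simp add: s_def)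
          ultimately show ?thesis
            using \<open>t \<noteq> 0\<close> by (simp add: power2_eq_square)
        qed
        moreover have "t * G (w t, t) \<noteq> 0"
          using \<open>t \<noteq> 0\<close> G(1) D(1) by simp
        moreover have "c1 (ut t, s) = 0"
          using elim by (simp add: s_def ut_def c1_F)
        \<comment> \<open>With \<open>s\<close> frozen, the terms depending on \<open>u\<close>
          alone are grouped as the \<open>g\<close> and \<open>h\<close> of the recognition lemma,
          and \<open>c1 (u, s)\<close> takes the role of \<open>b\<close>.\<close>
        ultimately have "cuspidal_cross_cap_at (\<lambda>(u, v). (u, (u^2 * f21 u + u * s * f24 (u, s)) + v^2,
            (u^2 * f31 u + u * s * f34 (u, s)) + v^2 * (c0 (u, s) + v * c1 (u, s)
              + v^2 * (\<lambda>p. c2 (fst p, snd p, s)) (u, v^2)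
              + v^3 * (\<lambda>p. c3 (fst p, snd p, s)) (u, v^2)))) (ut t, 0)"
          by (intro cuspidal_cross_cap_of_transversal_zero) ((intro smooth)?; simp)+
        then show "cuspidal_cross_cap_at (\<lambda>(u, v). f u v (- (t^2))) (ut t, 0)"
          unfolding f_def s_def by (simp add: algebra_simps)
      qed
    qed
    have "\<forall>\<^sub>F t in nhds 0. t \<noteq> 0 \<longrightarrow>
        cuspidal_cross_cap_at (\<lambda>(u, v). f u v (- (t^2))) (ut t, 0) \<and>
        cuspidal_cross_cap_at (\<lambda>(u, v). f u v (- (t^2))) (ut (- t), 0)"
      using ccc reflect[OF ccc] by eventually_elim simp
    from radius[OF this] show ?thesis
      by blast
  qed
  ultimately show ?thesis
    using smooth_ut unfolding Let_def D_def[symmetric] a_def b_def c_def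
    by (intro exI[of _ ut] conjI)
qed

end
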